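(* Let $(X,T)$ be a self-induced minimal Cantor system. Then $(X,T)$ is topologically conjugate to a generalized substitution subshift $(X_\sigma,S)$ where $\sigma$ is a recognizable, primitive, aperiodic generalized substitution on some alphabet space $K$.
   Context: A minimal Cantor system $(X,T)$ is self-induced if there is a nonempty clopen proper subset $U\subsetneq X$ such that the induced system $(U,T_U)$, $T_U(x)=T^{r_U(x)}x$ with $r_U(x)=\inf\{n>0:T^nx\in U\}$, is conjugate to $(X,T)$. An alphabet space is a compact zero-dimensional metric space $K$ with at least two points; $K^+$ is the set of nonempty finite words over $K$. A generalized substitution is a map $\sigma:K\to K^+$ with $a\mapsto|\sigma(a)|$ continuous and, for each $j$, $a\mapsto$ ($j$-th letter of $\sigma(a)$) continuous on $\{a:|\sigma(a)|\ge j\}$; it extends to words by concatenation and to $K^{\mathbb Z}$ by concatenating images with $\sigma(x_0)$ starting at coordinate $0$. $\sigma$ is primitive if for every nonempty open $V\subset K$ there is $j$ such that for all $a\in K$ and all $k\ge j$ some letter of $\sigma^k(a)$ lies in $V$. $\mathcal L(\sigma)$ is the set of words that are subwords of some $\sigma^j(a)$ ($a\in K$, $j\in\mathbb N$) or limits in $K^n$ of such words; $X_\sigma=\{\mathbf x\in K^{\mathbb Z}:\mathbf x[-n,n]\in\mathcal L(\sigma)\ \forall n\}$ with the shift $S$. $\sigma$ is aperiodic if $X_\sigma$ has no periodic points, and recognizable if every $\mathbf z\in X_\sigma$ admits a unique set of integers $\{n_k\}$ and unique $\mathbf x\in X_\sigma$ with $\sigma(x_k)=\mathbf z[n_k,n_{k+1}-1]$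 for all $k\in\mathbb Z$. *)

theory Defs
  imports "HOL-Analysis.Analysis" "HOL-Library.Sublist"
begin

definition zero_dimensional :: "'a::topological_space set \<Rightarrow> bool" where
  "zero_dimensional X \<longleftrightarrow>
     (\<forall>x\<in>X. \<forall>V. openin (top_of_set X) V \<and> x \<in> V \<longrightarrow>
        (\<exists>C. openin (top_of_set X) C \<and> closedin (top_of_set X) C \<and> x \<in> C \<and> C \<subseteq> V))"

definition cantor_space :: "'a::metric_space set \<Rightarrow> bool" where
  "cantor_space X \<longleftrightarrow> X \<noteq> {} \<and> compact X \<and> zero_dimensional X \<and> (\<forall>x\<in>X. x islimpt X)"

definition minimal_cantor_system :: "'a::metric_space set \<Rightarrow> ('a \<Rightarrow> 'a) \<Rightarrow> bool" where
  "minimal_cantor_system X T \<longleftrightarrow>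
     cantor_space X \<and> (\<exists>T'. homeomorphism X X T T') \<and>
     (\<forall>Y. closed Y \<and> Y \<subseteq> X \<and> T ` Y \<subseteq> Y \<longrightarrow> Y = {} \<or> Y = X)"

definition conjugate :: "'a::topological_space set \<Rightarrow> ('a \<Rightarrow> 'a) \<Rightarrow> 'b::topological_space set \<Rightarrow> ('b \<Rightarrow> 'b) \<Rightarrow> bool" where
  "conjugate X T Y S \<longleftrightarrow> (\<exists>h g. homeomorphism X Y h g \<and> (\<forall>x\<in>X. h (T x) = S (h x)))"

definition return_time :: "('a \<Rightarrow> 'a) \<Rightarrow> 'a set \<Rightarrow> 'a \<Rightarrow> nat" where
  "return_time T U x = (LEAST n. n > 0 \<and> (T ^^ n) x \<in> U)"

definition induced_map :: "('a \<Rightarrow> 'a) \<Rightarrow> 'a set \<Rightarrow> 'a \<Rightarrow> 'a" where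
  "induced_map T U x = (T ^^ return_time T U x) x"

definition self_induced :: "'a::metric_space set \<Rightarrow> ('a \<Rightarrow> 'a) \<Rightarrow> bool" where
  "self_induced X T \<longleftrightarrow>
     (\<exists>U. U \<noteq> {} \<and> U \<subset> X \<and> openin (top_of_set X) U \<and> closedin (top_of_set X) U \<and>
          conjugate U (induced_map T U) X T)"

text \<open>Alphabet spaces are realised as subsets of the Baire space nat \<Rightarrow> nat (product topology);
  every compact metrizable zero-dimensional space embeds there.\<close>
type_synonym letter = "nat \<Rightarrow> nat"

definition alphabet_space :: "letter set \<Rightarrow> bool" where
  "alphabet_space K \<longleftrightarrow> compact K \<and> zero_dimensional K \<and> (\<exists>a\<in>K. \<exists>b\<in>K. a \<noteq> b)"

definition gen_subst :: "letter set \<Rightarrow> (letter \<Rightarrow> letter list) \<Rightarrow> bool" where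
  "gen_subst K \<sigma> \<longleftrightarrow>
     (\<forall>a\<in>K. \<sigma> a \<noteq> [] \<and> set (\<sigma> a) \<subseteq> K) \<and>
     continuous_on K (\<lambda>a. length (\<sigma> a)) \<and>
     (\<forall>j. continuous_on {a\<in>K. j < length (\<sigma> a)} (\<lambda>a. \<sigma> a ! j))"

definition subst_word :: "(letter \<Rightarrow> letter list) \<Rightarrow> letter list \<Rightarrow> letter list" where
  "subst_word \<sigma> w = concat (map \<sigma> w)"

definition subst_iter :: "(letter \<Rightarrow> letter list) \<Rightarrow> nat \<Rightarrow> letter \<Rightarrow> letter list" where
  "subst_iter \<sigma> k a = (subst_word \<sigma> ^^ k) [a]"

definition primitive :: "letter set \<Rightarrow> (letter \<Rightarrow> letter list) \<Rightarrow> bool" where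
  "primitive K \<sigma> \<longleftrightarrow>
     (\<forall>V. openin (top_of_set K) V \<and> V \<noteq> {} \<longrightarrow>
        (\<exists>j. \<forall>a\<in>K. \<forall>k\<ge>j. \<exists>b\<in>set (subst_iter \<sigma> k a). b \<in> V))"

definition language :: "letter set \<Rightarrow> (letter \<Rightarrow> letter list) \<Rightarrow> letter list set" where
  "language K \<sigma> =
     {w. \<exists>u :: nat \<Rightarrow> letter list.
           (\<forall>m. length (u m) = length w \<and> (\<exists>a\<in>K. \<exists>j. sublist (u m) (subst_iter \<sigma> j a))) \<and>
           (\<forall>i<length w. (\<lambda>m. u m ! i) \<longlonglongrightarrow> w ! i)}"

definition subshift :: "letter set \<Rightarrow> (letter \<Rightarrow> letter list) \<Rightarrow> (int \<Rightarrow> letter) set" where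
  "subshift K \<sigma> = {x. (\<forall>i. x i \<in> K) \<and> (\<forall>n::int. map x [-n..n] \<in> language K \<sigma>)}"

definition shift :: "(int \<Rightarrow> letter) \<Rightarrow> (int \<Rightarrow> letter)" where
  "shift x = (\<lambda>i. x (i + 1))"

definition aperiodic :: "letter set \<Rightarrow> (letter \<Rightarrow> letter list) \<Rightarrow> bool" where
  "aperiodic K \<sigma> \<longleftrightarrow> \<not> (\<exists>x\<in>subshift K \<sigma>. \<exists>p>0. (shift ^^ p) x = x)"

text \<open>Recognizability: the cutting points are indexed so that n_0 \<le> 0 < n_1
  (matching the convention that \<sigma>(x_0) starts at coordinate 0); then the set {n_k}
  and x are unique iff the pair (n,x) is unique.\<close>
definition recognizable :: "letter set \<Rightarrow> (letter \<Rightarrow> letter list) \<Rightarrow> bool" where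
  "recognizable K \<sigma> \<longleftrightarrow>
     (\<forall>z\<in>subshift K \<sigma>. \<exists>!(n, x). strict_mono (n :: int \<Rightarrow> int) \<and> n 0 \<le> 0 \<and> 0 < n 1 \<and>
         x \<in> subshift K \<sigma> \<and> (\<forall>k. \<sigma> (x k) = map z [n k .. n (k + 1) - 1]))"

end

theory Submission
  imports Defs
begin

text \<open>
  Let \<psi> be the inverse of the conjugacy, from X onto U, and r x the return time of \<psi> x to U, so that
  \<psi> (T x) = T^(r x) (\<psi> x). Taking the points of X themselves as letters and letting \<sigma> x be the orbit
  segment of \<psi> x of length r x, every iterate of \<sigma> on a letter is again an orbit segment. If these
  segments grow, then minimality gives primitivity, the subshift consists exactly of the full
  orbits, and the cutting points of an orbit are its visits to the image of \<psi>, which is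
  recognizability. The segments need not grow for the given \<psi>, so \<psi> is first replaced by another
  inducing map with return times at least 2.
\<close>

section \<open>Locally constant maps and minimal homeomorphisms\<close>

text \<open>Coding a point by its own bi-infinite orbit makes conjugacy and aperiodicity easy once
  the subshift is identified; the weight lies on word lengths. The k-th iterate of \<sigma> at x is
  an orbit segment starting at \<open>(\<psi> ^^ k) x\<close>. Primitivity, and the presence of
  every orbit in the language, need its length to exceed, uniformly in x, the bounded time in which
  every orbit visits a given open set. Properness of U forces a return time of at least 2 somewhere,
  and minimality brings such a point within bounded time on every orbit. So long segments do grow
  under \<psi>, while a single letter may keep return time 1 forever. The remedy shares the growth
  of a long segment among its letters; the bound 2 then gives lengths of at least 2^k. The new map
  is not the inverse of the given conjugacy, so the argument uses only the properties collected in
  the locale \<open>inducing\<close>. These never name the image as a clopen set, and they can be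
  checked directly for the new map.\<close>

lemma continuous_on_select:
  fixes b :: "'a::topological_space \<Rightarrow> 'c::discrete_topology"
  assumes b: "continuous_on X b" and f: "\<And>n. continuous_on X (f n)"
  shows "continuous_on X (\<lambda>x. f (b x) x)"
  unfolding continuous_on_def
proof
  fix x assume x: "x \<in> X"
  have "\<forall>\<^sub>F y in at x within X. b y = b x"
    using b x by (auto simp: continuous_on_def tendsto_discrete)
  then have "\<forall>\<^sub>F y in at x within X. f (b x) y = f (b y) y"
    by eventually_elim simp
  moreover have "(f (b x) \<longlongrightarrow> f (b x) x) (at x within X)"
    using f x by (auto simp: continuous_on_def)
  ultimately show "((\<lambda>y. f (b y) y) \<longlongrightarrow> f (b x) x) (at x within X)"
    using tendsto_cong by fastforce
qed

text \<open>If m is the least index at x, only \<open>P 0\<close>, ..., \<open>P m\<close> matter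
  near x, and each of these finitely many predicates is locally constant.\<close>

lemma continuous_on_Least:
  fixes P :: "nat \<Rightarrow> 'a::topological_space \<Rightarrow> bool"
  assumes P: "\<And>n. continuous_on X (P n)" and ex: "\<And>x. x \<in> X \<Longrightarrow> \<exists>n. P n x"
  shows "continuous_on X (\<lambda>x. LEAST n. P n x)"
  unfolding continuous_on_def tendsto_discrete
proof
  fix x assume x: "x \<in> X"
  define m where "m = (LEAST n. P n x)"
  have m: "P m x" "\<And>n. n < m \<Longrightarrow> \<not> P n x"
    unfolding m_def using ex[OF x] by (auto intro: LeastI_ex dest: not_less_Least)
  have "\<forall>\<^sub>F y in at x within X. P n y = P n x" for n
    using P[of n] x by (auto simp: continuous_on_def tendsto_discrete)
  then have "\<forall>\<^sub>F y in at x within X. \<forall>n\<in>{..m}. P n y = P n x"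
    by (intro eventually_ball_finite) auto
  then show "\<forall>\<^sub>F y in at x within X. (LEAST n. P n y) = (LEAST n. P n x)"
    unfolding m_def[symmetric]
  proof eventually_elim
    case (elim y)
    show ?case
    proof (rule Least_equality)
      show "P m y" using elim m by auto
      fix n assume "P n y" then show "m \<le> n" using elim m by (meson atMost_iff leI less_imp_le)
    qed
  qed
qed

text \<open>Clopen sets are handled as continuous boolean functions, so that the two preceding
  lemmas apply to visiting times.\<close>

lemma continuous_on_membership:
  assumes f: "continuous_on X f" "f ` X \<subseteq> Y"
    and V: "openin (top_of_set Y) V" "closedin (top_of_set Y) V"
  shows "continuous_on X (\<lambda>x. f x \<in> V)"
  unfolding continuous_on_def tendsto_discrete
proof
  fix x assume x: "x \<in> X"
  obtain G where G: "open G" "V = Y \<inter> G" using V(1) by (auto simp: openin_open)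
  obtain H where H: "closed H" "V = Y \<inter> H" using V(2) by (auto simp: closedin_closed)
  have lim: "(f \<longlongrightarrow> f x) (at x within X)" using f x by (auto simp: continuous_on_def)
  have inX: "\<forall>\<^sub>F y in at x within X. y \<in> X"
    by (simp add: eventually_at_filter)
  show "\<forall>\<^sub>F y in at x within X. (f y \<in> V) = (f x \<in> V)"
  proof (cases "f x \<in> V")
    case True
    then have "\<forall>\<^sub>F y in at x within X. f y \<in> G"
      using topological_tendstoD[OF lim G(1)] G by auto
    with inX show ?thesis by eventually_elim (use True G f in auto)
  next
    case False
    then have "\<forall>\<^sub>F y in at x within X. f y \<in> - H"
      using topological_tendstoD[OF lim, of "- H"] H f x by auto
    with inX show ?thesis by eventually_elim (use False H f in auto)
  qed
qed

lemma continuous_on_nat_bounded: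
  fixes f :: "'a::topological_space \<Rightarrow> nat"
  assumes "compact X" "continuous_on X f"
  obtains N where "\<And>x. x \<in> X \<Longrightarrow> f x < N"
proof -
  have "compact (f ` X)" using assms by (rule compact_continuous_image[rotated])
  then have "finite (f ` X)" using compact_eq_Heine_Borel
    by (metis (no_types, lifting) compactE_image finite_UN finite.emptyI finite.insertI UN_singleton
        open_discrete order_refl finite_subset)
  then show ?thesis
    using that by (metis finite_nat_set_iff_bounded imageI)
qed

lemma funpow_funpow: "(f ^^ m) ((f ^^ n) x) = (f ^^ (m + n)) x"
  by (simp add: funpow_add)

lemma funpow_in: "f ` A \<subseteq> A \<Longrightarrow> x \<in> A \<Longrightarrow> (f ^^ n) x \<in> A"
  by (induction n) auto

lemma continuous_on_funpow:
  "continuous_on A f \<Longrightarrow> f ` A \<subseteq> A \<Longrightarrow> continuous_on A (f ^^ n)"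
proof (induction n)
  case (Suc n)
  have "continuous_on ((f ^^ n) ` A) f"
    by (rule continuous_on_subset[OF Suc.prems(1)]) (use funpow_in[OF Suc.prems(2)] in auto)
  with Suc show ?case using continuous_on_compose[of A "f ^^ n" f] by simp
qed (auto simp: id_def)

section \<open>Minimality: bounded visiting times and absence of periods\<close>

locale minimal_homeo =
  fixes X :: "'a::metric_space set" and T T' :: "'a \<Rightarrow> 'a"
  assumes compact_X: "compact X"
    and nonempty: "X \<noteq> {}"
    and homeo: "homeomorphism X X T T'"
    and minimal: "\<And>Y. closed Y \<Longrightarrow> Y \<subseteq> X \<Longrightarrow> T ` Y \<subseteq> Y \<Longrightarrow> Y = {} \<or> Y = X"
    and infinite_X: "infinite X"
begin

lemma T_image: "T ` X \<subseteq> X" and T'_image: "T' ` X \<subseteq> X"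
  and T_cont: "continuous_on X T" and T'_cont: "continuous_on X T'"
  and T'_T: "x \<in> X \<Longrightarrow> T' (T x) = x" and T_T': "x \<in> X \<Longrightarrow> T (T' x) = x"
  using homeo by (auto simp: homeomorphism_def)

lemma Tn_in [simp]: "x \<in> X \<Longrightarrow> (T ^^ n) x \<in> X"
  and T'n_in [simp]: "x \<in> X \<Longrightarrow> (T' ^^ n) x \<in> X"
  and T_in [simp]: "x \<in> X \<Longrightarrow> T x \<in> X"
  and T'_in [simp]: "x \<in> X \<Longrightarrow> T' x \<in> X"
  using funpow_in[OF T_image] funpow_in[OF T'_image] T_image T'_image by auto

lemma Tn_cont: "continuous_on X (T ^^ n)" and T'n_cont: "continuous_on X (T' ^^ n)"
  using continuous_on_funpow T_image T'_image T_cont T'_cont by auto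

lemma T'n_Tn: "x \<in> X \<Longrightarrow> (T' ^^ n) ((T ^^ n) x) = x"
  by (induction n arbitrary: x) (auto simp: T'_T funpow_swap1)

lemma Tn_T'n: "x \<in> X \<Longrightarrow> (T ^^ n) ((T' ^^ n) x) = x"
  by (induction n arbitrary: x) (auto simp: T_T' funpow_swap1)

lemma Tn_inj: "x \<in> X \<Longrightarrow> y \<in> X \<Longrightarrow> (T ^^ n) x = (T ^^ n) y \<Longrightarrow> x = y"
  by (metis T'n_Tn)

text \<open>The points whose forward orbit avoids V form a closed, forward invariant, proper subset,
  which is empty by minimality. Compactness then makes the waiting time uniform in x.\<close>

lemma visits:
  assumes V: "openin (top_of_set X) V" "V \<noteq> {}"
  obtains N where "\<And>x. x \<in> X \<Longrightarrow> \<exists>n<N. (T ^^ n) x \<in> V"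
proof -
  have op: "openin (top_of_set X) (X \<inter> (T ^^ n) -` V)" for n
    by (rule continuous_openin_preimage[OF Tn_cont _ V(1)]) auto
  define Y where "Y = X - (\<Union>n. X \<inter> (T ^^ n) -` V)"
  have "closedin (top_of_set X) Y"
    unfolding Y_def using op by (intro closedin_diff openin_Union) auto
  then have "closed Y"
    using compact_X by (meson closedin_closed_trans compact_imp_closed)
  moreover have "T ` Y \<subseteq> Y"
  proof -
    have Y_iff: "y \<in> Y \<longleftrightarrow> y \<in> X \<and> (\<forall>n. (T ^^ n) y \<notin> V)" for y
      unfolding Y_def by auto
    have "(T ^^ n) (T y) \<notin> V" if "y \<in> Y" for y n
      using that[unfolded Y_iff, THEN conjunct2, rule_format, of "Suc n"] by (simp add: funpow_swap1)
    then show ?thesis by (auto simp: Y_iff)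
  qed
  moreover have "Y \<noteq> X"
  proof -
    obtain v where "v \<in> V" using V by auto
    moreover have "v \<in> X" using V(1) \<open>v \<in> V\<close> openin_imp_subset by blast
    ultimately have "v \<in> X" "v \<notin> Y" unfolding Y_def by (auto intro: exI[of _ 0])
    then show ?thesis by auto
  qed
  ultimately have "Y = {}" using minimal[of Y] unfolding Y_def by blast
  then have cov: "\<exists>n. (T ^^ n) x \<in> V" if "x \<in> X" for x
    using that unfolding Y_def by auto
  obtain G where G: "open (G n)" "X \<inter> (T ^^ n) -` V = X \<inter> G n" for n
    using op[unfolded openin_open] by metis
  have "X \<subseteq> (\<Union>n\<in>UNIV. G n)"
  proof
    fix x assume "x \<in> X"
    moreover then obtain n where "(T ^^ n) x \<in> V" using cov by blast
    ultimately have "x \<in> X \<inter> G n" by (simp flip: G(2))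
    then show "x \<in> (\<Union>n\<in>UNIV. G n)" by blast
  qed
  then obtain C where C: "finite C" "X \<subseteq> (\<Union>c\<in>C. G c)"
    using compactE_image[OF compact_X, of UNIV G] G(1) by metis
  then obtain N where N: "\<forall>n\<in>C. n < N" using finite_nat_set_iff_bounded by blast
  show ?thesis
  proof (rule that[of N])
    fix x assume "x \<in> X"
    then obtain c where "c \<in> C" "x \<in> G c" using C by auto
    with \<open>x \<in> X\<close> G(2)[of c] N show "\<exists>n<N. (T ^^ n) x \<in> V" by blast
  qed
qed

text \<open>A periodic orbit is finite, hence closed and invariant, and would be all of the infinite
  space.\<close>

lemma no_periodic:
  assumes x: "x \<in> X" and p: "p > 0"
  shows "(T ^^ p) x \<noteq> x"
proof
  assume eq: "(T ^^ p) x = x"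
  let ?Y = "(\<lambda>n. (T ^^ n) x) ` {..<p}"
  have "T ` ?Y \<subseteq> ?Y"
  proof -
    have "T ((T ^^ n) x) \<in> ?Y" if "n < p" for n
    proof (cases "Suc n < p")
      case True
      then show ?thesis by (intro image_eqI[of _ _ "Suc n"]) auto
    next
      case False
      then have "Suc n = p" using that by simp
      then have "T ((T ^^ n) x) = x" using eq by auto
      then show ?thesis using p by (intro image_eqI[of _ _ 0]) auto
    qed
    then show ?thesis by auto
  qed
  moreover have "closed ?Y" by (simp add: finite_imp_closed)
  moreover have "?Y \<subseteq> X" using x by auto
  moreover have "?Y \<noteq> {}" using p by auto
  ultimately have "?Y = X" using minimal by blast
  then show False using infinite_X by (metis finite_imageI finite_lessThan)
qed

end

lemma minimal_cantor_system_imp_minimal_homeo: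
  assumes "minimal_cantor_system X T"
  obtains T' where "minimal_homeo X T T'"
proof -
  obtain T' where T': "homeomorphism X X T T'"
    using assms by (auto simp: minimal_cantor_system_def)
  have "cantor_space X" using assms by (auto simp: minimal_cantor_system_def)
  then have "infinite X" using islimpt_finite by (auto simp: cantor_space_def)
  show ?thesis
    by (rule that[of T'], unfold_locales)
       (use assms T' \<open>infinite X\<close> in \<open>auto simp: minimal_cantor_system_def cantor_space_def\<close>)
qed

section \<open>Inducing maps\<close>

text \<open>\<open>first_return\<close> carries two facts: for j = 0 it is injectivity of \<psi>,
  and for 0 < j it says that the orbit does not meet the image of \<psi> before time
  \<open>r x\<close>, when it does by \<open>psi_T\<close>.\<close>

locale inducing = minimal_homeo X T T' for X :: "'a::metric_space set" and T T' +
  fixes \<psi> :: "'a \<Rightarrow> 'a" and r :: "'a \<Rightarrow> nat"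
  assumes psi_cont: "continuous_on X \<psi>" and psi_in [simp]: "x \<in> X \<Longrightarrow> \<psi> x \<in> X"
    and r_cont: "continuous_on X r" and r_pos: "x \<in> X \<Longrightarrow> 0 < r x"
    and psi_T: "x \<in> X \<Longrightarrow> \<psi> (T x) = (T ^^ r x) (\<psi> x)"
    and first_return: "x \<in> X \<Longrightarrow> y \<in> X \<Longrightarrow> j < r x \<Longrightarrow> (T ^^ j) (\<psi> x) = \<psi> y \<Longrightarrow> j = 0 \<and> x = y"
begin

section \<open>Positions of the visits to the images of the iterates of \<psi>\<close>

definition cocycle :: "'a \<Rightarrow> nat \<Rightarrow> nat" where
  "cocycle x n = (\<Sum>i<n. r ((T ^^ i) x))"

lemma cocycle_0 [simp]: "cocycle x 0 = 0"
  and cocycle_Suc: "cocycle x (Suc n) = cocycle x n + r ((T ^^ n) x)"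
  by (simp_all add: cocycle_def)

lemma cocycle_ge: "x \<in> X \<Longrightarrow> n \<le> cocycle x n"
proof (induction n)
  case (Suc n)
  then show ?case using r_pos[of "(T ^^ n) x"] by (simp add: cocycle_Suc)
qed simp

lemma strict_mono_cocycle: "x \<in> X \<Longrightarrow> strict_mono (cocycle x)"
  by (auto simp: strict_mono_Suc_iff cocycle_Suc r_pos)

lemma cocycle_cont: "continuous_on X (\<lambda>x. cocycle x n)"
proof -
  have "continuous_on X (\<lambda>x. r ((T ^^ i) x))" for i
    by (rule continuous_on_compose2[OF r_cont Tn_cont]) auto
  then show ?thesis unfolding cocycle_def by (intro continuous_on_sum)
qed

lemma psi_Tn: "x \<in> X \<Longrightarrow> \<psi> ((T ^^ n) x) = (T ^^ cocycle x n) (\<psi> x)"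
proof (induction n)
  case (Suc n)
  then show ?case
    using psi_T[of "(T ^^ n) x"] by (simp add: cocycle_Suc funpow_funpow add.commute)
qed simp

text \<open>The values of \<open>cocycle x\<close> cut the forward orbit of \<open>\<psi> x\<close>
  into blocks. Inside the block containing j, \<open>first_return\<close> allows a visit only at its
  start.\<close>

lemma returns:
  assumes x: "x \<in> X" and y: "y \<in> X" and eq: "(T ^^ j) (\<psi> x) = \<psi> y"
  shows "\<exists>n. j = cocycle x n \<and> y = (T ^^ n) x"
proof -
  have "\<exists>n. j < cocycle x (Suc n)"
    using cocycle_ge[OF x, of "Suc j"] by (intro exI[of _ j]) simp
  then obtain n where n: "j < cocycle x (Suc n)" and least: "\<And>m. m < n \<Longrightarrow> \<not> j < cocycle x (Suc m)"
    using exists_least_iff[of "\<lambda>n. j < cocycle x (Suc n)"] by blast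
  have le: "cocycle x n \<le> j"
    using least by (cases n) (auto simp: not_less)
  have "(T ^^ (j - cocycle x n)) (\<psi> ((T ^^ n) x)) = \<psi> y"
    using le eq x by (simp add: psi_Tn funpow_funpow)
  moreover have "j - cocycle x n < r ((T ^^ n) x)"
    using n le by (simp add: cocycle_Suc)
  ultimately have "j - cocycle x n = 0 \<and> (T ^^ n) x = y"
    using first_return[OF Tn_in[OF x] y] by blast
  with le show ?thesis by auto
qed

lemma psi_n_in [simp]: "x \<in> X \<Longrightarrow> (\<psi> ^^ k) x \<in> X"
  by (induction k) auto

lemma psi_n_cont: "continuous_on X (\<psi> ^^ k)"
  by (rule continuous_on_funpow[OF psi_cont]) auto

text \<open>The time that n steps from x take after k applications of \<psi>, see
  \<open>psi_n_Tn\<close>. For n = 1 this will be the length of the k-th iterate of the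
  substitution.\<close>

primrec iter_cocycle :: "nat \<Rightarrow> 'a \<Rightarrow> nat \<Rightarrow> nat" where
  "iter_cocycle 0 x n = n"
| "iter_cocycle (Suc k) x n = cocycle ((\<psi> ^^ k) x) (iter_cocycle k x n)"

lemma iter_cocycle_0 [simp]: "iter_cocycle k x 0 = 0"
  by (induction k) auto

lemma strict_mono_iter_cocycle: "x \<in> X \<Longrightarrow> strict_mono (iter_cocycle k x)"
  by (induction k) (auto simp: strict_mono_def dest: strict_monoD[OF strict_mono_cocycle[OF psi_n_in]])

lemma iter_cocycle_cont: "continuous_on X (\<lambda>x. iter_cocycle k x n)"
proof (induction k)
  case (Suc k)
  have "continuous_on X (\<lambda>x. cocycle ((\<psi> ^^ k) x) m)" for m
    by (rule continuous_on_compose2[OF cocycle_cont psi_n_cont]) auto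
  then show ?case using continuous_on_select[OF Suc, of "\<lambda>m x. cocycle ((\<psi> ^^ k) x) m"] by simp
qed simp

lemma psi_n_Tn: "x \<in> X \<Longrightarrow> (\<psi> ^^ k) ((T ^^ n) x) = (T ^^ iter_cocycle k x n) ((\<psi> ^^ k) x)"
  by (induction k) (auto simp: psi_Tn)

lemma iter_returns:
  assumes x: "x \<in> X" and y: "y \<in> X"
  shows "(T ^^ j) ((\<psi> ^^ k) x) = (\<psi> ^^ k) y \<Longrightarrow> \<exists>n. j = iter_cocycle k x n \<and> y = (T ^^ n) x"
proof (induction k arbitrary: j)
  case (Suc k)
  then obtain m where m: "j = cocycle ((\<psi> ^^ k) x) m" "(\<psi> ^^ k) y = (T ^^ m) ((\<psi> ^^ k) x)"
    using returns[of "(\<psi> ^^ k) x" "(\<psi> ^^ k) y" j] x y by auto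
  then show ?case using Suc.IH[of m] by auto
qed simp

text \<open>The translates below form a closed invariant set, hence exhaust the space.\<close>

lemma tower:
  assumes y: "y \<in> X"
  obtains x j where "x \<in> X" "j < r x" "y = (T ^^ j) (\<psi> x)"
proof -
  obtain R where R: "\<And>x. x \<in> X \<Longrightarrow> r x < R"
    using continuous_on_nat_bounded[OF compact_X r_cont] by blast
  define Y where "Y = (\<Union>j<R. (\<lambda>x. (T ^^ j) (\<psi> x)) ` {x \<in> X. j < r x})"
  have Y_iff: "z \<in> Y \<longleftrightarrow> (\<exists>x j. x \<in> X \<and> j < r x \<and> z = (T ^^ j) (\<psi> x))" for z
  proof
    assume "\<exists>x j. x \<in> X \<and> j < r x \<and> z = (T ^^ j) (\<psi> x)"
    then obtain x j where "x \<in> X" "j < r x" "z = (T ^^ j) (\<psi> x)" by blast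
    moreover from this have "j < R" using R[of x] by simp
    ultimately show "z \<in> Y" unfolding Y_def by blast
  qed (auto simp: Y_def)
  have "compact {x \<in> X. j < r x}" for j
  proof -
    have "closedin (top_of_set X) (X \<inter> r -` {j<..})"
      by (rule continuous_closedin_preimage[OF r_cont]) (simp add: closed_def open_discrete)
    moreover have "X \<inter> r -` {j<..} = {x \<in> X. j < r x}" by auto
    ultimately show ?thesis using closedin_compact[OF compact_X] by simp
  qed
  moreover have "continuous_on {x \<in> X. j < r x} (\<lambda>x. (T ^^ j) (\<psi> x))" for j
    by (rule continuous_on_compose2[OF Tn_cont continuous_on_subset[OF psi_cont]]) auto
  ultimately have "compact Y"
    unfolding Y_def by (intro compact_UN compact_continuous_image) auto
  moreover have "Y \<subseteq> X" unfolding Y_def by auto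
  moreover have "T ` Y \<subseteq> Y"
  proof clarify
    fix z assume "z \<in> Y"
    then obtain x j where x: "x \<in> X" "j < r x" "z = (T ^^ j) (\<psi> x)" by (auto simp: Y_iff)
    show "T z \<in> Y"
    proof (cases "Suc j < r x")
      case True
      then show ?thesis unfolding Y_iff using x by (intro exI[of _ x] exI[of _ "Suc j"]) auto
    next
      \<comment> \<open>Leaving the top of the tower over x means entering the base of the tower
        over \<open>T x\<close>.\<close>
      case False
      then have "Suc j = r x" using x by simp
      then have "T z = \<psi> (T x)" using psi_T x by (metis funpow.simps(2) o_apply)
      then show ?thesis unfolding Y_iff using x r_pos[of "T x"]
        by (intro exI[of _ "T x"] exI[of _ 0]) auto
    qed
  qed
  moreover have "Y \<noteq> {}"
  proof -
    obtain x where "x \<in> X" using nonempty by auto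
    then have "\<psi> x \<in> Y" unfolding Y_iff using r_pos by (intro exI[of _ x] exI[of _ 0]) auto
    then show ?thesis by auto
  qed
  ultimately have "Y = X" using minimal compact_imp_closed by blast
  then show ?thesis using y Y_iff[of y] that by blast
qed

end

section \<open>The inducing map of a self-induced system\<close>

lemma (in minimal_homeo) self_induced_imp_inducing:
  assumes "self_induced X T"
  obtains \<psi> r where "inducing X T T' \<psi> r" "\<psi> ` X \<noteq> X"
proof -
  obtain U where U: "U \<noteq> {}" "U \<subset> X" "openin (top_of_set X) U" "closedin (top_of_set X) U"
    and conj: "conjugate U (induced_map T U) X T"
    using assms unfolding self_induced_def by blast
  obtain h g where hg: "homeomorphism U X h g" and h: "\<And>x. x \<in> U \<Longrightarrow> h (induced_map T U x) = T (h x)"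
    using conj unfolding conjugate_def by blast
  have g_in: "g x \<in> U" if "x \<in> X" for x using hg that by (auto simp: homeomorphism_def)
  have hgx: "h (g x) = x" if "x \<in> X" for x using hg that by (auto simp: homeomorphism_def)
  have ghx: "g (h x) = x" if "x \<in> U" for x using hg that by (auto simp: homeomorphism_def)
  define r where "r x = return_time T U (g x)" for x
  have gX: "g x \<in> X" if "x \<in> X" for x using g_in U that by auto
  have g_cont: "continuous_on X g" using hg by (auto simp: homeomorphism_def)
  obtain N where N: "\<And>x. x \<in> X \<Longrightarrow> \<exists>n<N. (T ^^ n) x \<in> U" using visits U by metis
  \<comment> \<open>The visit is sought from \<open>T (g x)\<close>, since \<open>g x\<close> itself
    lies in U and time 0 is no return.\<close>
  have ex: "\<exists>n. 0 < n \<and> (T ^^ n) (g x) \<in> U" if x: "x \<in> X" for x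
    using N[of "T (g x)"] gX[OF x] by (auto simp: funpow_swap1 intro: exI[of _ "Suc _"])
  have r: "0 < r x" "(T ^^ r x) (g x) \<in> U" if "x \<in> X" for x
    using LeastI_ex[OF ex[OF that]] unfolding r_def return_time_def by auto
  have r_least: "(T ^^ j) (g x) \<notin> U" if "0 < j" "j < r x" for x j
    using not_less_Least[of j] that unfolding r_def return_time_def by blast
  have g_T: "g (T x) = (T ^^ r x) (g x)" if x: "x \<in> X" for x
  proof -
    have "h ((T ^^ r x) (g x)) = T x"
      using h[OF g_in[OF x]] hgx[OF x] by (simp add: induced_map_def r_def)
    then show ?thesis using ghx[OF r(2)[OF x]] by simp
  qed
  have "inducing X T T' g r"
  proof unfold_locales
    show "continuous_on X r" unfolding r_def return_time_def
    proof (rule continuous_on_Least)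
      fix n
      have "continuous_on X (\<lambda>x. (T ^^ n) (g x) \<in> U)"
        by (rule continuous_on_membership[OF _ _ U(3,4)])
           (use gX in \<open>auto intro!: continuous_on_compose2[OF Tn_cont g_cont]\<close>)
      then show "continuous_on X (\<lambda>x. 0 < n \<and> (T ^^ n) (g x) \<in> U)"
        by (cases "0 < n") (simp_all)
    qed (use ex in auto)
    fix x y j assume xy: "x \<in> X" "y \<in> X" "j < r x" "(T ^^ j) (g x) = g y"
    then have "j = 0" using r_least[of j x] g_in[of y] by (metis gr0I)
    then show "j = 0 \<and> x = y" using xy hgx by (metis funpow_0)
  qed (use g_cont gX r g_T in auto)
  moreover have "g ` X \<noteq> X"
  proof -
    have "g ` X \<subseteq> U" using g_in by auto
    then show ?thesis using U(2) by auto
  qed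
  ultimately show ?thesis by (rule that)
qed

text \<open>A point p is not periodic, so a neighbourhood of it can be shrunk to separate p from its
  iterates one at a time. Disjointness from the iterates passes to a smaller clopen set.\<close>

lemma (in minimal_homeo) clopen_with_long_returns:
  assumes zd: "zero_dimensional X"
  obtains V where "openin (top_of_set X) V" "closedin (top_of_set X) V" "V \<noteq> {}"
    "\<And>x i. x \<in> V \<Longrightarrow> 0 < i \<Longrightarrow> i < N \<Longrightarrow> (T ^^ i) x \<notin> V"
proof -
  obtain p where p: "p \<in> X" using nonempty by auto
  have "\<exists>G. openin (top_of_set X) G \<and> p \<in> G \<and> (\<forall>x\<in>G. \<forall>i. 0 < i \<and> i < N \<longrightarrow> (T ^^ i) x \<notin> G)"
  proof (induction N)
    case 0
    show ?case using p by (intro exI[of _ X]) auto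
  next
    case (Suc N)
    then obtain G where G: "openin (top_of_set X) G" "p \<in> G"
      "\<And>x i. x \<in> G \<Longrightarrow> 0 < i \<Longrightarrow> i < N \<Longrightarrow> (T ^^ i) x \<notin> G" by blast
    show ?case
    proof (cases "N = 0")
      case True
      then show ?thesis using G by (intro exI[of _ G]) auto
    next
      case False
      then have "(T ^^ N) p \<noteq> p" using no_periodic[OF p] by simp
      then obtain P Q where PQ: "open P" "open Q" "p \<in> P" "(T ^^ N) p \<in> Q" "P \<inter> Q = {}"
        using hausdorff[of p "(T ^^ N) p"] by metis
      let ?G = "G \<inter> P \<inter> (X \<inter> (T ^^ N) -` Q)"
      have "openin (top_of_set X) (G \<inter> P)"
        using G(1) PQ(1) by (rule openin_Int_open)
      then have "openin (top_of_set X) ?G"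
        using continuous_openin_preimage_gen[OF Tn_cont PQ(2)] by (rule openin_Int)
      moreover have "p \<in> ?G" using G PQ p by auto
      moreover have "(T ^^ i) x \<notin> ?G" if "x \<in> ?G" "0 < i" "i < Suc N" for x i
        using that G(3)[of x i] PQ(5) by (cases "i = N") auto
      ultimately show ?thesis by (intro exI[of _ ?G]) blast
    qed
  qed
  then obtain G where G: "openin (top_of_set X) G" "p \<in> G"
    "\<And>x i. x \<in> G \<Longrightarrow> 0 < i \<Longrightarrow> i < N \<Longrightarrow> (T ^^ i) x \<notin> G" by blast
  from zd[unfolded zero_dimensional_def, rule_format, OF p, OF conjI[OF G(1,2)]]
  obtain V where V: "openin (top_of_set X) V" "closedin (top_of_set X) V" "p \<in> V" "V \<subseteq> G"
    by auto
  show ?thesis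
  proof (rule that[OF V(1,2)])
    show "(T ^^ i) x \<notin> V" if "x \<in> V" "0 < i" "i < N" for x i
      using G(3)[of x i] that V(4) by auto
  qed (use V(3) in auto)
qed

section \<open>Making all return times at least 2\<close>

context inducing
begin

text \<open>A segment of at least N points contains one with return time at least 2, so \<psi>
  lengthens it by at least 1. The length stays at least N, and the argument repeats.\<close>

lemma iter_cocycle_growth:
  assumes N: "\<And>x. x \<in> X \<Longrightarrow> \<exists>n<N. 2 \<le> r ((T ^^ n) x)" and x: "x \<in> X" and n: "N \<le> n"
  shows "n + k \<le> iter_cocycle k x n"
proof (induction k)
  case (Suc k)
  let ?m = "iter_cocycle k x n" and ?y = "(\<psi> ^^ k) x"
  have y: "?y \<in> X" using x by simp
  obtain i where i: "i < N" "2 \<le> r ((T ^^ i) ?y)" using N[OF y] by blast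
  have "(\<Sum>i<?m. 1) < cocycle ?y ?m"
    unfolding cocycle_def
  proof (rule sum_strict_mono_ex1)
    show "\<forall>i\<in>{..<?m}. 1 \<le> r ((T ^^ i) ?y)" using r_pos y by (simp add: Suc_le_eq)
    show "\<exists>i\<in>{..<?m}. 1 < r ((T ^^ i) ?y)" using i n Suc by (intro bexI[of _ i]) auto
  qed simp
  then show ?case using Suc by simp
qed simp

text \<open>The return time may stay equal to 1 under iteration of \<psi> (as for the Chacon
  substitution). Over a clopen set V with long returns, k iterations stretch each excursion of
  length n from V to length at least 2 n; re-spacing the points of the excursion two apart inside
  the stretched one gives an inducing map whose return times are all at least 2.\<close>

lemma inducing_with_returns_ge_2:
  assumes proper: "\<psi> ` X \<noteq> X" and zd: "zero_dimensional X"
  obtains \<psi>' r' where "inducing X T T' \<psi>' r'" "\<And>x. x \<in> X \<Longrightarrow> 2 \<le> r' x"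
proof -
  let ?A = "X \<inter> r -` {2..}"
  have "openin (top_of_set X) ?A"
    by (rule continuous_openin_preimage_gen[OF r_cont]) (simp add: open_discrete)
  moreover have "?A \<noteq> {}"
  proof
    \<comment> \<open>If all return times were 1, \<psi> would commute with T and its image would be
      closed and invariant, hence all of X.\<close>
    assume empty: "?A = {}"
    have "r x = 1" if "x \<in> X" for x
    proof -
      have "\<not> 2 \<le> r x" using empty that by auto
      then show ?thesis using r_pos[OF that] by simp
    qed
    then have "T (\<psi> x) = \<psi> (T x)" if "x \<in> X" for x using psi_T that by simp
    then have "T ` \<psi> ` X \<subseteq> \<psi> ` X" by force
    moreover have "compact (\<psi> ` X)" by (rule compact_continuous_image[OF psi_cont compact_X])
    ultimately show False
      using minimal[of "\<psi> ` X"] proper nonempty psi_in compact_imp_closed by blast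
  qed
  ultimately obtain N where "\<And>x. x \<in> X \<Longrightarrow> \<exists>n<N. (T ^^ n) x \<in> ?A" using visits by metis
  then have N: "\<exists>n<N. 2 \<le> r ((T ^^ n) x)" if "x \<in> X" for x using that by fastforce
  \<comment> \<open>With the same N as above, every excursion from V is long enough for
    \<open>iter_cocycle_growth\<close>.\<close>
  obtain V where V: "openin (top_of_set X) V" "closedin (top_of_set X) V" "V \<noteq> {}"
    and long: "\<And>x i. x \<in> V \<Longrightarrow> 0 < i \<Longrightarrow> i < N \<Longrightarrow> (T ^^ i) x \<notin> V"
    using clopen_with_long_returns[OF zd] by metis
  have VX: "x \<in> X" if "x \<in> V" for x using V(1) that openin_imp_subset by blast
  \<comment> \<open>k bounds the waiting time for V and is also the number of iterations of \<psi>: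
    an excursion of length n becomes at least n + k long, and the height \<open>b y\<close> is below
    both n and k, whence the factor 2 in \<open>stretch\<close>.\<close>
  obtain k where k: "\<And>x. x \<in> X \<Longrightarrow> \<exists>n<k. (T ^^ n) x \<in> V" using visits[OF V(1,3)] by metis
  \<comment> \<open>Going back k - 1 steps and waiting forward for V lands at or before y.\<close>
  have backwards: "\<exists>i<k. (T' ^^ i) y \<in> V" if y: "y \<in> X" for y
  proof -
    obtain n where n: "n < k" "(T ^^ n) ((T' ^^ (k - 1)) y) \<in> V"
      using k[of "(T' ^^ (k - 1)) y"] y by auto
    have "(T' ^^ (k - 1)) y = (T' ^^ n) ((T' ^^ (k - 1 - n)) y)"
      using n(1) by (simp add: funpow_funpow)
    then have "(T' ^^ (k - 1 - n)) y \<in> V" using n(2) y by (simp add: Tn_T'n)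
    moreover have "k - 1 - n < k" using n by simp
    ultimately show ?thesis by blast
  qed
  define b where "b y = (LEAST i. (T' ^^ i) y \<in> V)" for y
  define base where "base y = (T' ^^ b y) y" for y
  have base_V: "base y \<in> V" if "y \<in> X" for y
    unfolding base_def b_def using backwards[OF that] by (auto intro: LeastI)
  have base_X: "base y \<in> X" if "y \<in> X" for y using base_V VX that by auto
  have b_le: "b y < k" if "y \<in> X" for y
    unfolding b_def using backwards[OF that] by (meson Least_le le_less_trans)
  have T_base: "(T ^^ b y) (base y) = y" if "y \<in> X" for y
    unfolding base_def using that by (simp add: Tn_T'n)
  have not_V: "(T ^^ i) (base y) \<notin> V" if y: "y \<in> X" and i: "0 < i" "i \<le> b y" for y i
  proof -
    have "base y = (T' ^^ i) ((T' ^^ (b y - i)) y)"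
      unfolding base_def using i by (simp add: funpow_funpow)
    then have "(T ^^ i) (base y) = (T' ^^ (b y - i)) y" using y by (simp add: Tn_T'n)
    moreover have "b y - i < (LEAST i. (T' ^^ i) y \<in> V)" using i unfolding b_def by simp
    then have "(T' ^^ (b y - i)) y \<notin> V" by (rule not_less_Least)
    ultimately show ?thesis by simp
  qed
  have b_T: "b (T y) = (if T y \<in> V then 0 else Suc (b y))" if y: "y \<in> X" for y
  proof (cases "T y \<in> V")
    case True
    then show ?thesis by (simp add: b_def)
  next
    case False
    have unshift: "(T' ^^ Suc i) (T y) = (T' ^^ i) y" for i
      using y by (simp add: funpow_Suc_right T'_T del: funpow.simps)
    have "b (T y) = Suc (LEAST i. (T' ^^ Suc i) (T y) \<in> V)"
      unfolding b_def
    proof (rule Least_Suc)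
      show "(T' ^^ Suc (b y)) (T y) \<in> V" using base_V[OF y] by (simp only: unshift base_def)
    qed (use False in simp)
    then show ?thesis using False by (simp only: unshift b_def if_False)
  qed
  have base_T: "base (T y) = (if T y \<in> V then T y else base y)" if y: "y \<in> X" for y
    using y by (simp add: base_def b_T T'_T funpow_Suc_right del: funpow.simps(2))
  \<comment> \<open>The point at height \<open>b y\<close> of its excursion is placed at position
    \<open>2 * b y\<close> of the stretched one. The last point takes all the remaining length; by
    \<open>stretch\<close> this is at least 2, so the natural subtraction in \<open>r'\<close> does
    not truncate.\<close>
  define \<psi>' where "\<psi>' y = (T ^^ (2 * b y)) ((\<psi> ^^ k) (base y))" for y
  define r' where "r' y = (if T y \<in> V then iter_cocycle k (base y) (Suc (b y)) - 2 * b y else 2)" for y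
  have stretch: "2 * Suc (b y) \<le> iter_cocycle k (base y) n"
    if y: "y \<in> X" and n: "0 < n" "(T ^^ n) (base y) \<in> V" for y n
  proof -
    have "N \<le> n" using long[OF base_V[OF y] n(1)] n(2) by (meson not_less)
    with N base_X[OF y] have "n + k \<le> iter_cocycle k (base y) n" by (rule iter_cocycle_growth)
    moreover have "b y < n" using not_V[OF y n(1)] n(2) by (meson not_less)
    ultimately show ?thesis using b_le[OF y] by simp
  qed
  have T_y: "T y = (T ^^ Suc (b y)) (base y)" if "y \<in> X" for y
    using T_base[OF that] by simp
  \<comment> \<open>The stretch belonging to y ends no later than the image of any subsequent visit
    to V; this confines collisions to a single excursion.\<close>
  have r'_le: "r' y + 2 * b y \<le> iter_cocycle k (base y) n"
    if y: "y \<in> X" and n: "0 < n" "(T ^^ n) (base y) \<in> V" for y n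
  proof (cases "T y \<in> V")
    case True
    have "b y < n" using not_V[OF y n(1)] n(2) by (meson not_less)
    then have "iter_cocycle k (base y) (Suc (b y)) \<le> iter_cocycle k (base y) n"
      using strict_mono_iter_cocycle[OF base_X[OF y]] by (simp add: strict_mono_less_eq)
    moreover have "2 * Suc (b y) \<le> iter_cocycle k (base y) (Suc (b y))"
      using stretch[OF y, of "Suc (b y)"] True T_y[OF y] by simp
    ultimately show ?thesis using True by (simp add: r'_def)
  next
    case False
    then show ?thesis using stretch[OF y n] by (simp add: r'_def)
  qed
  have r'_ge: "2 \<le> r' y" if y: "y \<in> X" for y
    using stretch[OF y, of "Suc (b y)"] T_y[OF y] by (auto simp: r'_def)
  have cancel: "(T ^^ (m - n)) x = y" if "(T ^^ m) x = (T ^^ n) y" "n \<le> m" "x \<in> X" "y \<in> X" for m n x y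
  proof (rule Tn_inj)
    show "(T ^^ n) ((T ^^ (m - n)) x) = (T ^^ n) y"
      using that by (simp add: funpow_funpow)
  qed (use that in auto)
  have "inducing X T T' \<psi>' r'"
  proof unfold_locales
    have b_cont: "continuous_on X b"
      unfolding b_def
    proof (rule continuous_on_Least)
      show "continuous_on X (\<lambda>y. (T' ^^ n) y \<in> V)" for n
        by (rule continuous_on_membership[OF T'n_cont _ V(1,2)]) auto
    qed (use backwards in blast)
    have "continuous_on X (\<lambda>y. (T ^^ (2 * n)) ((\<psi> ^^ k) ((T' ^^ n) y)))" for n
      by (rule continuous_on_compose2[OF Tn_cont continuous_on_compose2[OF psi_n_cont T'n_cont]]) auto
    from continuous_on_select[OF b_cont this] show "continuous_on X \<psi>'"
      by (simp add: \<psi>'_def[abs_def] base_def)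
    have "continuous_on X (\<lambda>y. iter_cocycle k ((T' ^^ n) y) (Suc n) - 2 * n)" for n
    proof -
      have "continuous_on X (\<lambda>y. iter_cocycle k ((T' ^^ n) y) (Suc n))"
        by (rule continuous_on_compose2[OF iter_cocycle_cont T'n_cont]) auto
      from continuous_on_select[OF this, of "\<lambda>m _. m - 2 * n"] show ?thesis by simp
    qed
    from continuous_on_select[OF b_cont this]
    have top: "continuous_on X (\<lambda>y. iter_cocycle k (base y) (Suc (b y)) - 2 * b y)"
      by (simp add: base_def)
    have TV: "continuous_on X (\<lambda>y. T y \<in> V)"
      by (rule continuous_on_membership[OF T_cont _ V(1,2)]) auto
    have "continuous_on X (\<lambda>y. if c then iter_cocycle k (base y) (Suc (b y)) - 2 * b y else 2)" for c
      using top by (cases c) auto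
    from continuous_on_select[OF TV this] show "continuous_on X r'"
      by (simp add: r'_def[abs_def])
    show "\<psi>' x \<in> X" if "x \<in> X" for x using that base_X by (simp add: \<psi>'_def)
    show "0 < r' x" if "x \<in> X" for x using r'_ge[OF that] by simp
    show "\<psi>' (T x) = (T ^^ r' x) (\<psi>' x)" if x: "x \<in> X" for x
    proof (cases "T x \<in> V")
      case True
      have "\<psi>' (T x) = (\<psi> ^^ k) ((T ^^ Suc (b x)) (base x))"
        using True x b_T base_T T_y by (simp add: \<psi>'_def del: funpow.simps)
      also have "\<dots> = (T ^^ iter_cocycle k (base x) (Suc (b x))) ((\<psi> ^^ k) (base x))"
        by (rule psi_n_Tn[OF base_X[OF x]])
      also have "iter_cocycle k (base x) (Suc (b x)) = r' x + 2 * b x"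
        using True stretch[OF x, of "Suc (b x)"] T_y[OF x] by (simp add: r'_def)
      finally show ?thesis by (simp add: \<psi>'_def funpow_add)
    next
      case False
      then have "2 * b (T x) = r' x + 2 * b x" using x b_T by (simp add: r'_def)
      moreover have "base (T x) = base x" using False x base_T by simp
      ultimately show ?thesis by (simp only: \<psi>'_def funpow_add o_apply)
    qed
    fix x y j assume x: "x \<in> X" and y: "y \<in> X" and j: "j < r' x" and eq: "(T ^^ j) (\<psi>' x) = \<psi>' y"
    have eq: "(T ^^ (j + 2 * b x)) ((\<psi> ^^ k) (base x)) = (T ^^ (2 * b y)) ((\<psi> ^^ k) (base y))"
      using eq by (simp add: \<psi>'_def funpow_add)
    show "j = 0 \<and> x = y"
    proof (cases "2 * b y \<le> j + 2 * b x")
      case True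
      from cancel[OF eq True] have "(T ^^ (j + 2 * b x - 2 * b y)) ((\<psi> ^^ k) (base x)) = (\<psi> ^^ k) (base y)"
        using x y base_X by simp
      then obtain n where n: "j + 2 * b x - 2 * b y = iter_cocycle k (base x) n" "base y = (T ^^ n) (base x)"
        using iter_returns[OF base_X[OF x] base_X[OF y]] by blast
      \<comment> \<open>A later visit of the orbit of \<open>base x\<close> to V lies beyond the
        stretch of x, which contains position \<open>j + 2 * b x\<close>.\<close>
      have "n = 0"
      proof (rule ccontr)
        assume "n \<noteq> 0"
        then have "r' x + 2 * b x \<le> iter_cocycle k (base x) n"
          using r'_le[OF x] n(2) base_V[OF y] by simp
        then show False using n(1) j by linarith
      qed
      then have base: "base y = base x" and jb: "2 * b y = j + 2 * b x" using n True by auto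
      \<comment> \<open>On a common base \<open>b x \<le> b y\<close>. If x is the last point of the
        excursion, y cannot be higher; otherwise j < 2 and parity gives j = 0.\<close>
      have "b y = b x"
      proof (cases "T x \<in> V")
        case T: True
        then have "\<not> Suc (b x) \<le> b y"
          using not_V[OF y, of "Suc (b x)"] T_y[OF x] base by auto
        then show ?thesis using jb by simp
      next
        case False
        then have "j < 2" using j by (simp add: r'_def)
        then show ?thesis using jb by presburger
      qed
      then show ?thesis using jb base T_base x y by (metis add_right_cancel add_0)
    next
      \<comment> \<open>Now \<open>base x\<close> would be a strictly later visit from
        \<open>base y\<close>, beyond the stretch of y, although position \<open>j + 2 * b x\<close>
        comes before \<open>2 * b y\<close>.\<close>
      case False
      then have le: "j + 2 * b x \<le> 2 * b y" by simp
      from cancel[OF eq[symmetric] le]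
      have "(T ^^ (2 * b y - (j + 2 * b x))) ((\<psi> ^^ k) (base y)) = (\<psi> ^^ k) (base x)"
        using x y base_X by simp
      then obtain n where n: "2 * b y - (j + 2 * b x) = iter_cocycle k (base y) n" "base x = (T ^^ n) (base y)"
        using iter_returns[OF base_X[OF y] base_X[OF x]] by blast
      have "n \<noteq> 0"
      proof
        assume "n = 0"
        then have "iter_cocycle k (base y) n = 0" by simp
        then show False using n(1) False by linarith
      qed
      then have "r' y + 2 * b y \<le> iter_cocycle k (base y) n"
        using r'_le[OF y] n(2) base_V[OF x] by simp
      then show ?thesis using n(1) r'_ge[OF y] by linarith
    qed
  qed
  then show ?thesis by (rule that) (rule r'_ge)
qed

end

section \<open>Embedding into the Baire space\<close>

text \<open>Function spaces carry no Hausdorff instance for the codomain nat, so compactness is exploited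
  through the coding into sequences of reals.\<close>

lemma zero_dimensional_compact_embeds:
  fixes X :: "'a::metric_space set"
  assumes X: "compact X" and zd: "zero_dimensional X"
  obtains e :: "'a \<Rightarrow> nat \<Rightarrow> nat" and g where "homeomorphism X (e ` X) e g"
proof -
  have "\<forall>n. \<forall>x\<in>X. \<exists>C. openin (top_of_set X) C \<and> closedin (top_of_set X) C \<and> x \<in> C \<and>
    C \<subseteq> X \<inter> ball x (1 / Suc n)"
  proof (intro allI ballI)
    fix n x assume x: "x \<in> X"
    show "\<exists>C. openin (top_of_set X) C \<and> closedin (top_of_set X) C \<and> x \<in> C \<and>
      C \<subseteq> X \<inter> ball x (1 / Suc n)"
    using zd[unfolded zero_dimensional_def, rule_format, OF x, of "X \<inter> ball x (1 / Suc n)"] x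
      by (simp add: openin_open_Int)
  qed
  from this[unfolded bchoice_iff choice_iff] obtain C where C: "openin (top_of_set X) (C n x)" "closedin (top_of_set X) (C n x)"
    "x \<in> C n x" "C n x \<subseteq> X \<inter> ball x (1 / Suc n)" if "x \<in> X" for x n
    by blast
  have "\<exists>F. finite F \<and> F \<subseteq> X \<and> X \<subseteq> (\<Union>x\<in>F. C n x)" for n
  proof -
    have "\<exists>G. open G \<and> C n x = X \<inter> G" if "x \<in> X" for x
      using C(1)[OF that, of n] by (auto simp: openin_open)
    then obtain G where G: "open (G x)" "C n x = X \<inter> G x" if "x \<in> X" for x by metis
    have "X \<subseteq> (\<Union>x\<in>X. G x)" using C(3)[of _ n] G(2) by auto
    then obtain F where F: "F \<subseteq> X" "finite F" "X \<subseteq> (\<Union>x\<in>F. G x)"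
      using compactE_image[OF X, of X G] G(1) by metis
    have "X \<subseteq> (\<Union>x\<in>F. C n x)"
    proof
      fix y assume y: "y \<in> X"
      then obtain x where "x \<in> F" "y \<in> G x" using F by auto
      then show "y \<in> (\<Union>x\<in>F. C n x)" using G(2)[of x] F(1) y by auto
    qed
    then show ?thesis using F by auto
  qed
  then obtain F where F: "finite (F n)" "F n \<subseteq> X" "X \<subseteq> (\<Union>x\<in>F n. C n x)" for n by metis
  \<comment> \<open>A countable family of clopen sets of arbitrarily small diameter covering X; the
    empty set is added so that the enumeration ranges over a nonempty set.\<close>
  define D where "D = insert {} (\<Union>n. C n ` F n)"
  define c where "c = from_nat_into D"
  have "countable D" unfolding D_def using F(1) by (auto intro: countable_finite)
  then have range_c: "range c = D" unfolding c_def D_def by (intro range_from_nat_into) auto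
  have clopen: "openin (top_of_set X) (c n)" "closedin (top_of_set X) (c n)" for n
  proof -
    have "c n \<in> D" using range_c by auto
    then have "c n = {} \<or> (\<exists>m x. x \<in> X \<and> c n = C m x)" unfolding D_def using F(2) by blast
    then show "openin (top_of_set X) (c n)" "closedin (top_of_set X) (c n)"
      using C(1,2) by auto
  qed
  define e where "e x n = (of_bool (x \<in> c n) :: nat)" for x n
  define e' where "e' x n = real (e x n)" for x n
  have inj: "x = y" if x: "x \<in> X" and y: "y \<in> X" and eq: "e x = e y" for x y
  proof (rule ccontr)
    assume "x \<noteq> y"
    then have "0 < dist x y / 2" by simp
    then obtain n where n: "inverse (real (Suc n)) < dist x y / 2" using reals_Archimedean by blast
    obtain p where p: "p \<in> F n" "x \<in> C n p" using F(3) x by blast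
    then have pX: "p \<in> X" using F(2) by auto
    have "C n p \<in> D" unfolding D_def using p by auto
    then obtain m where m: "c m = C n p" using range_c by (metis imageE)
    have "e x m = e y m" using eq by simp
    then have "y \<in> C n p" using m p by (auto simp: e_def of_bool_def split: if_splits)
    then have "dist p x < 1 / Suc n" "dist p y < 1 / Suc n"
      using C(4)[OF pX, of n] p by auto
    then have "dist x y < 2 / Suc n" using dist_triangle3[of x y p] by simp
    then show False using n by (simp add: field_simps)
  qed
  have bool_cont: "continuous_on X (\<lambda>x. x \<in> c n)" for n
    using continuous_on_membership[OF continuous_on_id _ clopen] by auto
  have e_cont: "continuous_on X e"
  proof (rule continuous_on_coordinatewise_then_product)
    show "continuous_on X (\<lambda>x. e x n)" for n
      using continuous_on_select[OF bool_cont[of n], of "\<lambda>t _. of_bool t :: nat"]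
      by (simp add: e_def)
  qed
  have e'_cont: "continuous_on X e'"
  proof (rule continuous_on_coordinatewise_then_product)
    show "continuous_on X (\<lambda>x. e' x n)" for n
      using continuous_on_select[OF bool_cont[of n], of "\<lambda>t _. real (of_bool t)"]
      by (simp add: e'_def e_def)
  qed
  have "inj_on e' X"
  proof (rule inj_onI)
    fix x y assume xy: "x \<in> X" "y \<in> X" "e' x = e' y"
    have "e x = e y"
    proof
      fix n
      have "e' x n = e' y n" using xy by simp
      then show "e x n = e y n" by (simp add: e'_def)
    qed
    then show "x = y" using inj xy by blast
  qed
  then obtain g' where g': "homeomorphism X (e' ` X) e' g'"
    using homeomorphism_compact[OF X e'_cont refl] by blast
  define g where "g f = g' (\<lambda>n. real (f n))" for f :: "nat \<Rightarrow> nat"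
  have ge: "g (e x) = x" if "x \<in> X" for x
  proof -
    have "(\<lambda>n. real (e x n)) = e' x" by (auto simp: e'_def)
    then show ?thesis using g' that by (simp add: g_def homeomorphism_def)
  qed
  have g_cont: "continuous_on (e ` X) g"
    unfolding g_def[abs_def]
  proof (rule continuous_on_compose2[where g = g' and f = "\<lambda>f n. real (f n)"])
    show "continuous_on (e' ` X) g'" using g' by (simp add: homeomorphism_def)
    show "continuous_on (e ` X) (\<lambda>f n. real (f n))"
      by (intro continuous_on_coordinatewise_then_product continuous_on_of_nat)
         (rule continuous_on_subset[OF continuous_on_product_coordinates], simp)
    show "(\<lambda>f n. real (f n)) ` e ` X \<subseteq> e' ` X" by (auto simp: e'_def[abs_def])
  qed
  have "homeomorphism X (e ` X) e g"
    unfolding homeomorphism_def using e_cont g_cont ge by (auto simp: image_iff)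
  then show ?thesis by (rule that)
qed

lemma zero_dimensional_homeomorphic_image:
  assumes zd: "zero_dimensional X" and hom: "homeomorphism X K e g"
  shows "zero_dimensional K"
  unfolding zero_dimensional_def
proof (intro ballI allI impI, elim conjE)
  fix a V assume a: "a \<in> K" and V: "openin (top_of_set K) V" and aV: "a \<in> V"
  have cont: "continuous_on X e" "continuous_on K g" and im: "e ` X = K" "g ` K = X"
    and inv: "\<And>a. a \<in> K \<Longrightarrow> e (g a) = a" using hom by (auto simp: homeomorphism_def)
  have "openin (top_of_set X) (X \<inter> e -` V)"
    by (rule continuous_openin_preimage[OF cont(1) _ V]) (use im in auto)
  moreover have "g a \<in> X" "g a \<in> X \<inter> e -` V" using a aV im inv by auto
  ultimately obtain C where C: "openin (top_of_set X) C" "closedin (top_of_set X) C" "g a \<in> C" "C \<subseteq> X \<inter> e -` V"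
    using zd[unfolded zero_dimensional_def] by meson
  have "openin (top_of_set K) (K \<inter> g -` C)"
    by (rule continuous_openin_preimage[OF cont(2) _ C(1)]) (use im in auto)
  moreover have "closedin (top_of_set K) (K \<inter> g -` C)"
    using continuous_closedin_preimage_gen[OF cont(2) _ C(2)] im by auto
  moreover have "a \<in> K \<inter> g -` C" using a C by auto
  moreover have "K \<inter> g -` C \<subseteq> V"
  proof
    fix b assume "b \<in> K \<inter> g -` C"
    then have "b \<in> K" "e (g b) \<in> V" using C(4) by auto
    then show "b \<in> V" using inv by simp
  qed
  ultimately show "\<exists>C. openin (top_of_set K) C \<and> closedin (top_of_set K) C \<and> a \<in> C \<and> C \<subseteq> V"
    by blast
qed

section \<open>Coding by a generalized substitution\<close>

context minimal_homeo
begin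

definition zpow :: "int \<Rightarrow> 'a \<Rightarrow> 'a" where
  "zpow i x = (if 0 \<le> i then (T ^^ nat i) x else (T' ^^ nat (- i)) x)"

lemma zpow_0 [simp]: "zpow 0 x = x"
  by (simp add: zpow_def)

lemma zpow_in [simp]: "x \<in> X \<Longrightarrow> zpow i x \<in> X"
  by (simp add: zpow_def)

lemma zpow_cont: "continuous_on X (zpow i)"
  using Tn_cont T'n_cont by (cases "0 \<le> i") (simp_all add: zpow_def[abs_def])

lemma zpow_int: "zpow (int n) x = (T ^^ n) x"
  by (simp add: zpow_def)

lemma zpow_Suc:
  assumes x: "x \<in> X"
  shows "zpow (i + 1) x = T (zpow i x)"
proof (cases "0 \<le> i")
  case True
  then have "nat (i + 1) = Suc (nat i)" by simp
  then show ?thesis using True by (simp add: zpow_def)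
next
  case False
  then have "nat (- i) = Suc (nat (- (i + 1)))" by simp
  then have "T (zpow i x) = (T' ^^ nat (- (i + 1))) x" using False x by (simp add: zpow_def T_T')
  moreover have "zpow (i + 1) x = (T' ^^ nat (- (i + 1))) x"
    using False by (cases "i = -1") (auto simp: zpow_def)
  ultimately show ?thesis by simp
qed

text \<open>Upwards the orbit is determined by T, downwards by injectivity of T. This serves both
  for \<open>zpow_add\<close> and to recognise the sequences of the subshift as orbits.\<close>

lemma orbit_eq_zpow:
  assumes in_X: "\<And>i. z i \<in> X" and step: "\<And>i. z (i + 1) = T (z i)"
  shows "z i = zpow i (z 0)"
proof (induction i rule: int_induct[of _ 0])
  case (step1 i)
  then show ?case using step zpow_Suc[OF in_X] by simp
next
  case (step2 i)
  have "T (z (i - 1)) = T (zpow (i - 1) (z 0))"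
    using step2 step[of "i - 1"] zpow_Suc[OF in_X, of "i - 1" 0] by simp
  then show ?case using T'_T in_X zpow_in by metis
qed simp

lemma zpow_add: "x \<in> X \<Longrightarrow> zpow (i + j) x = zpow i (zpow j x)"
  using orbit_eq_zpow[of "\<lambda>i. zpow (i + j) x" i] zpow_Suc[of x "_ + j"] by (simp add: add_ac)

definition orb :: "'a \<Rightarrow> nat \<Rightarrow> 'a list" where
  "orb x n = map (\<lambda>i. (T ^^ i) x) [0..<n]"

lemma length_orb [simp]: "length (orb x n) = n"
  by (simp add: orb_def)

lemma nth_orb: "i < n \<Longrightarrow> orb x n ! i = (T ^^ i) x"
  by (simp add: orb_def)

lemma set_orb: "x \<in> X \<Longrightarrow> set (orb x n) \<subseteq> X"
  by (auto simp: orb_def)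

lemma orb_add: "orb x (m + n) = orb x m @ orb ((T ^^ m) x) n"
  by (rule nth_equalityI) (auto simp: nth_append nth_orb funpow_funpow)

lemma orb_zpow:
  assumes x: "x \<in> X"
  shows "orb (zpow a x) (nat (b - a)) = map (\<lambda>i. zpow i x) [a..b - 1]"
proof (rule nth_equalityI)
  fix i assume "i < length (orb (zpow a x) (nat (b - a)))"
  then have i: "i < nat (b - a)" by simp
  have "zpow (a + int i) x = (T ^^ i) (zpow a x)"
    using zpow_add[OF x, of "int i" a] by (simp add: zpow_int add.commute)
  then show "orb (zpow a x) (nat (b - a)) ! i = map (\<lambda>i. zpow i x) [a..b - 1] ! i"
    using i by (simp add: nth_orb nth_upto)
qed simp

end

context inducing
begin

text \<open>The extension of \<open>cocycle\<close> to negative times. At most one of the two sums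
  is nonempty, which makes the recursion \<open>zcocycle_Suc\<close> valid across 0.\<close>

definition zcocycle :: "'a \<Rightarrow> int \<Rightarrow> int" where
  "zcocycle x k = (\<Sum>i\<in>{0..<k}. int (r (zpow i x))) - (\<Sum>i\<in>{k..<0}. int (r (zpow i x)))"

lemma zcocycle_0 [simp]: "zcocycle x 0 = 0"
  by (simp add: zcocycle_def)

lemma zcocycle_Suc: "zcocycle x (k + 1) = zcocycle x k + int (r (zpow k x))"
proof (cases "0 \<le> k")
  case True
  then have "{0..<k + 1} = insert k {0..<k}" by auto
  then show ?thesis using True by (simp add: zcocycle_def)
next
  case False
  then have "{k..<0} = insert k {k + 1..<0}" by auto
  then show ?thesis using False by (simp add: zcocycle_def)
qed

lemma psi_zpow:
  assumes x: "x \<in> X"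
  shows "\<psi> (zpow k x) = zpow (zcocycle x k) (\<psi> x)"
proof -
  have step: "\<psi> (zpow (k + 1) x) = (T ^^ r (zpow k x)) (\<psi> (zpow k x))"
    and step': "zpow (zcocycle x (k + 1)) (\<psi> x) = (T ^^ r (zpow k x)) (zpow (zcocycle x k) (\<psi> x))" for k
    using x zpow_add[of "\<psi> x" "int (r (zpow k x))" "zcocycle x k"]
    by (simp_all add: zpow_Suc psi_T zcocycle_Suc zpow_int add.commute[of "int _"])
  show ?thesis
  proof (induction k rule: int_induct[of _ 0])
    case (step1 i)
    then show ?case by (simp add: step step')
  next
    case (step2 i)
    show ?case
      by (rule Tn_inj[where n = "r (zpow (i - 1) x)"])
         (use step2 step[of "i - 1"] step'[of "i - 1"] x in auto)
  qed simp
qed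

end

text \<open>The type of letters is fixed, so the points of X become letters through a homeomorphism
  \<open>e\<close> with inverse \<open>g\<close>.\<close>

locale coding = inducing X T T' \<psi> r for X :: "'a::metric_space set" and T T' \<psi> r +
  fixes K :: "letter set" and e g
  assumes hom: "homeomorphism X K e g"
    and r_ge_2: "x \<in> X \<Longrightarrow> 2 \<le> r x"
begin

lemma e_in [simp]: "x \<in> X \<Longrightarrow> e x \<in> K" and g_in [simp]: "a \<in> K \<Longrightarrow> g a \<in> X"
  and g_e [simp]: "x \<in> X \<Longrightarrow> g (e x) = x" and e_g [simp]: "a \<in> K \<Longrightarrow> e (g a) = a"
  and e_cont: "continuous_on X e" and g_cont: "continuous_on K g"
  using hom by (auto simp: homeomorphism_def)

definition \<sigma> :: "letter \<Rightarrow> letter list" where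
  "\<sigma> a = map e (orb (\<psi> (g a)) (r (g a)))"

lemma gen_subst: "gen_subst K \<sigma>"
proof -
  have "\<sigma> a \<noteq> []" "set (\<sigma> a) \<subseteq> K" if "a \<in> K" for a
  proof -
    have "length (\<sigma> a) > 0" using r_pos that by (simp add: \<sigma>_def)
    then show "\<sigma> a \<noteq> []" by auto
    show "set (\<sigma> a) \<subseteq> K" using set_orb[OF psi_in[OF g_in[OF that]], of "r (g a)"] by (auto simp: \<sigma>_def)
  qed
  moreover have "continuous_on K (\<lambda>a. length (\<sigma> a))"
    using continuous_on_compose2[OF r_cont g_cont] by (simp add: \<sigma>_def image_subset_iff)
  moreover have "continuous_on {a\<in>K. j < length (\<sigma> a)} (\<lambda>a. \<sigma> a ! j)" for j
  proof -
    have "continuous_on K (\<lambda>a. e ((T ^^ j) (\<psi> (g a))))"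
      by (intro continuous_on_compose2[OF e_cont] continuous_on_compose2[OF Tn_cont]
          continuous_on_compose2[OF psi_cont] g_cont) auto
    then have "continuous_on {a\<in>K. j < length (\<sigma> a)} (\<lambda>a. e ((T ^^ j) (\<psi> (g a))))"
      by (rule continuous_on_subset) auto
    then show ?thesis
      by (rule continuous_on_eq) (simp add: \<sigma>_def nth_orb)
  qed
  ultimately show ?thesis by (simp add: gen_subst_def)
qed

text \<open>Images of consecutive letters fit together because the segment of
  \<open>\<psi> x\<close> stops just before \<open>\<psi> (T x)\<close>.\<close>

lemma subst_word_orb:
  assumes x: "x \<in> X"
  shows "subst_word \<sigma> (map e (orb x n)) = map e (orb (\<psi> x) (cocycle x n))"
proof (induction n)
  case 0
  show ?case by (simp add: subst_word_def orb_def)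
next
  case (Suc n)
  have "orb x (Suc n) = orb x n @ [(T ^^ n) x]" by (simp add: orb_def)
  then have "subst_word \<sigma> (map e (orb x (Suc n))) = map e (orb (\<psi> x) (cocycle x n)) @ \<sigma> (e ((T ^^ n) x))"
    using Suc by (simp add: subst_word_def)
  also have "\<dots> = map e (orb (\<psi> x) (cocycle x (Suc n)))"
    using x by (simp add: \<sigma>_def psi_Tn cocycle_Suc orb_add)
  finally show ?case .
qed

lemma subst_iter_code:
  assumes x: "x \<in> X"
  shows "subst_iter \<sigma> k (e x) = map e (orb ((\<psi> ^^ k) x) (iter_cocycle k x 1))"
proof (induction k)
  case 0
  show ?case by (simp add: subst_iter_def orb_def)
next
  case (Suc k)
  then show ?case using x by (simp add: subst_iter_def subst_word_orb)
qed

lemma iter_cocycle_ge_power: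
  assumes x: "x \<in> X"
  shows "2 ^ k \<le> iter_cocycle k x 1"
proof (induction k)
  case (Suc k)
  have "2 * n \<le> cocycle y n" if "y \<in> X" for y n
    using sum_mono[of "{..<n}" "\<lambda>_. 2" "\<lambda>i. r ((T ^^ i) y)"] that r_ge_2 by (simp add: cocycle_def)
  from this[of "(\<psi> ^^ k) x" "iter_cocycle k x 1"] show ?case using Suc x by simp
qed simp

lemma primitive: "primitive K \<sigma>"
  unfolding primitive_def
proof (intro allI impI, elim conjE)
  fix V assume V: "openin (top_of_set K) V" "V \<noteq> {}"
  have "openin (top_of_set X) (X \<inter> e -` V)"
    by (rule continuous_openin_preimage[OF e_cont _ V(1)]) auto
  moreover have "X \<inter> e -` V \<noteq> {}"
  proof -
    obtain a where "a \<in> V" using V by auto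
    moreover from this have "a \<in> K" using V(1) openin_imp_subset by blast
    ultimately have "g a \<in> X \<inter> e -` V" by simp
    then show ?thesis by auto
  qed
  ultimately obtain N where N: "\<And>x. x \<in> X \<Longrightarrow> \<exists>n<N. (T ^^ n) x \<in> X \<inter> e -` V"
    using visits by metis
  show "\<exists>j. \<forall>a\<in>K. \<forall>k\<ge>j. \<exists>b\<in>set (subst_iter \<sigma> k a). b \<in> V"
  \<comment> \<open>For k at least N the word has at least 2^k > N letters, so the orbit segment is
    longer than the waiting time N.\<close>
  proof (intro exI[of _ N] ballI allI impI)
    fix a k assume a: "a \<in> K" and k: "N \<le> k"
    let ?x = "g a"
    have x: "?x \<in> X" using a by simp
    obtain n where n: "n < N" "(T ^^ n) ((\<psi> ^^ k) ?x) \<in> X \<inter> e -` V" using N[of "(\<psi> ^^ k) ?x"] x by auto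
    have "k < 2 ^ k" by simp
    then have "n < iter_cocycle k ?x 1" using n(1) k iter_cocycle_ge_power[OF x, of k] by linarith
    then have "e ((T ^^ n) ((\<psi> ^^ k) ?x)) \<in> set (subst_iter \<sigma> k (e ?x))"
      unfolding subst_iter_code[OF x] by (simp add: orb_def)
    then show "\<exists>b\<in>set (subst_iter \<sigma> k a). b \<in> V" using n(2) a by auto
  qed
qed

text \<open>The segment of y itself need not occur in an iterate, which only shows orbits of points
  \<open>(\<psi> ^^ k) x\<close>. These orbits come arbitrarily close to y, and the language is
  closed under limits.\<close>

lemma orb_in_language:
  assumes y: "y \<in> X"
  shows "map e (orb y l) \<in> language K \<sigma>"
proof -
  have "\<exists>w\<in>X. dist w y < 1 / Suc m \<and> (\<exists>k. sublist (map e (orb w l)) (subst_iter \<sigma> k (e y)))" for m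
  proof -
    have "openin (top_of_set X) (X \<inter> ball y (1 / Suc m))" by (simp add: openin_open_Int)
    moreover have "X \<inter> ball y (1 / Suc m) \<noteq> {}" using y by (auto intro!: exI[of _ y])
    ultimately obtain N where N: "\<And>x. x \<in> X \<Longrightarrow> \<exists>n<N. (T ^^ n) x \<in> X \<inter> ball y (1 / Suc m)"
      using visits by metis
    \<comment> \<open>Leaves room for l further letters after a visit at a time below N.\<close>
    define k where "k = N + l"
    let ?v = "(\<psi> ^^ k) y"
    obtain n where n: "n < N" "(T ^^ n) ?v \<in> X \<inter> ball y (1 / Suc m)" using N[of ?v] y by auto
    have "k < 2 ^ k" by simp
    then have "n + l \<le> iter_cocycle k y 1"
      using n(1) iter_cocycle_ge_power[OF y, of k] unfolding k_def by linarith
    then obtain q where "iter_cocycle k y 1 = n + (l + q)" by (auto simp: le_iff_add)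
    then have "subst_iter \<sigma> k (e y) = map e (orb ?v n) @ map e (orb ((T ^^ n) ?v) l) @
        map e (orb ((T ^^ l) ((T ^^ n) ?v)) q)"
      unfolding subst_iter_code[OF y] by (simp only: orb_add map_append)
    then have "sublist (map e (orb ((T ^^ n) ?v) l)) (subst_iter \<sigma> k (e y))" by simp
    moreover have "dist ((T ^^ n) ?v) y < 1 / Suc m" using n(2) by (simp add: dist_commute)
    ultimately show ?thesis using n(2) by blast
  qed
  then obtain w where w: "w m \<in> X" "dist (w m) y < 1 / Suc m"
      "\<exists>k. sublist (map e (orb (w m) l)) (subst_iter \<sigma> k (e y))" for m
    by metis
  have lim: "w \<longlonglongrightarrow> y"
  proof (rule metric_LIMSEQ_I)
    fix \<epsilon> :: real assume "0 < \<epsilon>"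
    then obtain N where N: "1 / Suc N < \<epsilon>" by (rule nat_approx_posE)
    have "dist (w m) y < \<epsilon>" if "N \<le> m" for m
    proof -
      have "1 / Suc m \<le> 1 / Suc N" using that by (simp add: frac_le)
      then show ?thesis using w(2)[of m] N by linarith
    qed
    then show "\<exists>N. \<forall>m\<ge>N. dist (w m) y < \<epsilon>" by blast
  qed
  show ?thesis
    unfolding language_def
  proof (intro CollectI exI[of _ "\<lambda>m. map e (orb (w m) l)"] conjI allI impI)
    fix m
    show "\<exists>a\<in>K. \<exists>j. sublist (map e (orb (w m) l)) (subst_iter \<sigma> j a)"
      using w(3)[of m] y e_in by blast
  next
    fix i assume "i < length (map e (orb y l))"
    then have i: "i < l" by simp
    have "continuous_on X (\<lambda>x. e ((T ^^ i) x))"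
      by (rule continuous_on_compose2[OF e_cont Tn_cont]) auto
    from continuous_on_tendsto_compose[OF this lim y] w(1)
    show "(\<lambda>m. map e (orb (w m) l) ! i) \<longlonglongrightarrow> map e (orb y l) ! i"
      using i by (simp add: nth_orb)
  qed simp
qed

text \<open>Exact subwords of iterates are orbit segments, and the relation between consecutive
  letters is closed, so it survives limits.\<close>

lemma language_step:
  assumes w: "w \<in> language K \<sigma>" "set w \<subseteq> K" and p: "Suc p < length w"
  shows "g (w ! Suc p) = T (g (w ! p))"
proof -
  obtain u where u: "\<And>m. length (u m) = length w" "\<And>m. \<exists>a\<in>K. \<exists>j. sublist (u m) (subst_iter \<sigma> j a)"
    and lim: "\<And>i. i < length w \<Longrightarrow> (\<lambda>m. u m ! i) \<longlonglongrightarrow> w ! i"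
    using w(1) unfolding language_def by blast
  have "\<exists>v\<in>X. \<forall>i<length w. u m ! i = e ((T ^^ i) v)" for m
  proof -
    obtain a j where a: "a \<in> K" "sublist (u m) (subst_iter \<sigma> j a)" using u(2) by blast
    let ?v = "(\<psi> ^^ j) (g a)"
    obtain b c where "map e (orb ?v (iter_cocycle j (g a) 1)) = b @ u m @ c"
      using a subst_iter_code[of "g a" j] by (auto simp: sublist_def)
    then have bc: "b @ u m @ c = map e (orb ?v (iter_cocycle j (g a) 1))" by simp
    then have len: "length b + length (u m) + length c = iter_cocycle j (g a) 1"
      by (metis length_append length_map length_orb add.assoc)
    have "u m ! i = e ((T ^^ i) ((T ^^ length b) ?v))" if "i < length w" for i
    proof -
      have "u m ! i = (b @ u m @ c) ! (length b + i)" using that u(1) by (simp add: nth_append)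
      also have "\<dots> = e ((T ^^ (length b + i)) ?v)"
        unfolding bc using that u(1)[of m] len by (simp add: nth_orb)
      finally show ?thesis by (simp add: funpow_funpow add.commute)
    qed
    moreover have "(T ^^ length b) ?v \<in> X" using a by simp
    ultimately show ?thesis by blast
  qed
  then obtain v where v: "v m \<in> X" "\<And>i. i < length w \<Longrightarrow> u m ! i = e ((T ^^ i) (v m))" for m
    by metis
  have wK: "w ! i \<in> K" if "i < length w" for i using w(2) that by auto
  have lim_g: "(\<lambda>m. (T ^^ i) (v m)) \<longlonglongrightarrow> g (w ! i)" if i: "i < length w" for i
  proof -
    have "(\<lambda>m. g (u m ! i)) \<longlonglongrightarrow> g (w ! i)"
      by (rule continuous_on_tendsto_compose[OF g_cont lim[OF i] wK[OF i]])
         (simp add: v i)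
    then show ?thesis using v i by simp
  qed
  have "(\<lambda>m. T ((T ^^ p) (v m))) \<longlonglongrightarrow> T (g (w ! p))"
    by (rule continuous_on_tendsto_compose[OF T_cont lim_g]) (use p wK v in auto)
  moreover have "(\<lambda>m. T ((T ^^ p) (v m))) \<longlonglongrightarrow> g (w ! Suc p)"
    using lim_g[OF p] by simp
  ultimately show ?thesis by (rule LIMSEQ_unique[rotated])
qed

section \<open>The subshift as the space of full orbits\<close>

definition code :: "'a \<Rightarrow> int \<Rightarrow> letter" where
  "code x = (\<lambda>i. e (zpow i x))"

lemma subshift_eq: "subshift K \<sigma> = code ` X"
proof (intro equalityI subsetI)
  fix z assume "z \<in> code ` X"
  then obtain x where x: "x \<in> X" "z = code x" by auto
  have "map z [-n..n] \<in> language K \<sigma>" for n :: int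
    using orb_in_language[of "zpow (- n) x" "nat (n + 1 - (- n))"] x orb_zpow[of x "-n" "n + 1"]
    by (simp add: code_def comp_def)
  then show "z \<in> subshift K \<sigma>" using x by (auto simp: subshift_def code_def)
next
  fix z assume "z \<in> subshift K \<sigma>"
  then have K: "\<And>i. z i \<in> K" and lang: "\<And>n::int. map z [-n..n] \<in> language K \<sigma>"
    by (auto simp: subshift_def)
  have "g (z (i + 1)) = T (g (z i))" for i
  proof -
    \<comment> \<open>The window from -n to n contains both i and i + 1; p is the list index of
      i.\<close>
    define n where "n = \<bar>i\<bar> + 1"
    define p where "p = nat (i + n)"
    have p: "Suc p < length [-n..n]" "int p = i + n" unfolding p_def n_def by auto
    then have "[-n..n] ! p = i" "[-n..n] ! Suc p = i + 1" by (auto simp: nth_upto)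
    moreover have "g (map z [-n..n] ! Suc p) = T (g (map z [-n..n] ! p))"
      by (rule language_step[OF lang]) (use K p in auto)
    ultimately show ?thesis using p(1) by (simp add: nth_map del: length_upto)
  qed
  then have orbit: "g (z i) = zpow i (g (z 0))" for i
    using orbit_eq_zpow[of "\<lambda>i. g (z i)", OF g_in[OF K]] by blast
  have "z i = code (g (z 0)) i" for i
    using e_g[OF K, of i] orbit[of i] by (simp only: code_def)
  then have "z = code (g (z 0))" by (rule ext)
  then show "z \<in> code ` X" using g_in[OF K] by (rule image_eqI)
qed

lemma code_shift: "x \<in> X \<Longrightarrow> code (T x) = shift (code x)"
  using zpow_add[of x _ 1] by (auto simp: code_def shift_def zpow_Suc[of x 0, simplified])

lemma conjugate: "conjugate X T (subshift K \<sigma>) shift"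
  unfolding conjugate_def
proof (intro exI conjI ballI)
  show "homeomorphism X (subshift K \<sigma>) code (\<lambda>z. g (z 0))"
    unfolding homeomorphism_def subshift_eq
  proof (intro conjI ballI)
    show "continuous_on X code"
    proof (rule continuous_on_coordinatewise_then_product)
      show "continuous_on X (\<lambda>x. code x i)" for i
        unfolding code_def by (rule continuous_on_compose2[OF e_cont zpow_cont]) auto
    qed
    have "continuous_on (code ` X) (\<lambda>z. z 0)"
      by (rule continuous_on_subset[OF continuous_on_product_coordinates]) simp
    then show "continuous_on (code ` X) (\<lambda>z. g (z 0))"
      by (rule continuous_on_compose2[OF g_cont]) (auto simp: code_def)
  qed (auto simp: code_def image_iff)
qed (rule code_shift)

lemma aperiodic: "aperiodic K \<sigma>"
  unfolding aperiodic_def subshift_eq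
proof clarify
  fix x p assume x: "x \<in> X" and p: "0 < p" and eq: "(shift ^^ p) (code x) = code x"
  have "(shift ^^ n) (code x) = code ((T ^^ n) x)" for n
    by (induction n) (use x code_shift in auto)
  then have "code ((T ^^ p) x) 0 = code x 0" using eq by simp
  then have "(T ^^ p) x = x" using x g_e by (metis Tn_in code_def zpow_0)
  then show False using no_periodic[OF x p] by simp
qed

section \<open>Recognizability\<close>

definition desubstitution :: "(int \<Rightarrow> letter) \<Rightarrow> (int \<Rightarrow> int) \<Rightarrow> (int \<Rightarrow> letter) \<Rightarrow> bool" where
  "desubstitution z n y \<longleftrightarrow> strict_mono n \<and> n 0 \<le> 0 \<and> 0 < n 1 \<and> y \<in> subshift K \<sigma> \<and>
     (\<forall>k. \<sigma> (y k) = map z [n k .. n (k + 1) - 1])"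

text \<open>By \<open>tower\<close>, z sits j steps above some \<open>\<psi> x\<close>. The cutting
  points are the visit positions of that orbit moved by -j, and j < \<open>r x\<close> places 0 in
  the block of index 0.\<close>

lemma desubstitution_exists:
  assumes z: "z \<in> X"
  shows "\<exists>n y. desubstitution (code z) n y"
proof -
  obtain x j where x: "x \<in> X" "j < r x" "z = (T ^^ j) (\<psi> x)" using tower[OF z] by metis
  define n where "n k = zcocycle x k - int j" for k
  have n_Suc: "n (k + 1) = n k + int (r (zpow k x))" for k by (simp add: n_def zcocycle_Suc)
  have r: "0 < r (zpow k x)" for k using r_pos x by simp
  have mono: "n k < n (k + 1 + int m)" for k m
  proof (induction m)
    case 0
    show ?case using r[of k] by (simp add: n_Suc)
  next
    case (Suc m)
    have "n (k + 1 + int (Suc m)) = n (k + 1 + int m) + int (r (zpow (k + 1 + int m) x))"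
      using n_Suc[of "k + 1 + int m"] by (simp add: algebra_simps)
    then show ?case using Suc by simp
  qed
  have "strict_mono n"
  proof (rule strict_monoI)
    fix a b :: int assume "a < b"
    then have "b = a + 1 + int (nat (b - a - 1))" by simp
    then show "n a < n b" using mono by metis
  qed
  moreover have "n 0 \<le> 0" "0 < n 1" using n_Suc[of 0] x by (auto simp: n_def)
  moreover have "code x \<in> subshift K \<sigma>" using x by (simp add: subshift_eq)
  moreover have "\<sigma> (code x k) = map (code z) [n k..n (k + 1) - 1]" for k
  proof -
    have "zpow (n k) z = zpow (n k) (zpow (int j) (\<psi> x))" using x by (simp add: zpow_int)
    also have "\<dots> = zpow (zcocycle x k) (\<psi> x)"
      using x zpow_add[of "\<psi> x" "n k" "int j"] by (simp add: n_def)
    finally have "zpow (n k) z = \<psi> (zpow k x)" using psi_zpow x by simp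
    moreover have "nat (n (k + 1) - n k) = r (zpow k x)" by (simp add: n_Suc)
    ultimately have "orb (\<psi> (zpow k x)) (r (zpow k x)) = map (\<lambda>i. zpow i z) [n k..n (k + 1) - 1]"
      using orb_zpow[OF z, of "n k" "n (k + 1)"] by simp
    then show ?thesis using x by (simp add: \<sigma>_def code_def comp_def)
  qed
  ultimately show ?thesis unfolding desubstitution_def by blast
qed

text \<open>Comparing lengths of the words gives the gaps, and comparing first letters gives the
  points at the cuts.\<close>

lemma desubstitutionE:
  assumes "desubstitution (code z) n y" and z: "z \<in> X"
  obtains x where "x \<in> X" "y = code x" "n 0 \<le> 0" "0 < n 1"
    "\<And>k. n (k + 1) = n k + int (r (zpow k x))" "\<And>k. zpow (n k) z = \<psi> (zpow k x)"
proof -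
  obtain x where x: "x \<in> X" "y = code x"
    using assms by (auto simp: desubstitution_def subshift_eq)
  have mono: "n k < n (k + 1)" for k
    using assms by (auto simp: desubstitution_def strict_mono_def)
  have eq: "map e (orb (\<psi> (zpow k x)) (r (zpow k x))) = map (code z) [n k..n (k + 1) - 1]" for k
    using assms x by (simp add: desubstitution_def \<sigma>_def code_def)
  have len: "r (zpow k x) = nat (n (k + 1) - n k)" for k
    using arg_cong[OF eq[of k], of length] by simp
  have "e (\<psi> (zpow k x)) = code z (n k)" for k
    using arg_cong[OF eq[of k], of "\<lambda>l. l ! 0"] mono[of k] len[of k]
    by (simp add: nth_orb nth_upto)
  then have "\<psi> (zpow k x) = zpow (n k) z" for k
    using x z g_e by (metis code_def psi_in zpow_in)
  moreover have "n (k + 1) = n k + int (r (zpow k x))" for k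
    using len[of k] mono[of k] by simp
  ultimately show ?thesis using that x assms by (auto simp: desubstitution_def)
qed

text \<open>Both blocks of index 0 contain coordinate 0, so \<open>m 0\<close> lies in the block
  from \<open>n 0\<close> to \<open>n 1\<close>, and \<open>first_return\<close> forces equal starts
  and equal points. The gaps then determine all other cuts.\<close>

lemma desubstitution_unique:
  assumes n: "desubstitution (code z) n y" and m: "desubstitution (code z) m y'"
    and z: "z \<in> X" and le: "n 0 \<le> m 0"
  shows "n = m \<and> y = y'"
proof -
  obtain x where x: "x \<in> X" "y = code x" "0 < n 1"
    "\<And>k. n (k + 1) = n k + int (r (zpow k x))" "\<And>k. zpow (n k) z = \<psi> (zpow k x)"
    using desubstitutionE[OF n z] by metis
  obtain x' where x': "x' \<in> X" "y' = code x'" "m 0 \<le> 0"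
    "\<And>k. m (k + 1) = m k + int (r (zpow k x'))" "\<And>k. zpow (m k) z = \<psi> (zpow k x')"
    using desubstitutionE[OF m z] by metis
  define d where "d = nat (m 0 - n 0)"
  have d: "m 0 = int d + n 0" using le by (simp add: d_def)
  have "(T ^^ d) (\<psi> x) = \<psi> x'"
    using zpow_add[OF z, of "int d" "n 0"] x(5)[of 0] x'(5)[of 0] d by (simp add: zpow_int)
  moreover have "d < r x" using d x(3) x(4)[of 0] x'(3) by simp
  ultimately have "d = 0" and xx': "x = x'" using first_return[OF x(1) x'(1)] by blast+
  have "n k = m k" for k
  proof (induction k rule: int_induct[of _ 0])
    case base
    then show ?case using d \<open>d = 0\<close> by simp
  next
    case (step1 i)
    then show ?case using x(4) x'(4) xx' by simp
  next
    case (step2 i)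
    then show ?case using x(4)[of "i - 1"] x'(4)[of "i - 1"] xx' by simp
  qed
  then show ?thesis using x(2) x'(2) xx' by auto
qed

lemma recognizable: "recognizable K \<sigma>"
  unfolding recognizable_def
proof
  fix z assume "z \<in> subshift K \<sigma>"
  then obtain x where x: "x \<in> X" "z = code x" by (auto simp: subshift_eq)
  obtain n y where ny: "desubstitution z n y" using desubstitution_exists x by blast
  have unique: "(m, y') = (n, y)" if m: "desubstitution z m y'" for m y'
  proof (cases "n 0 \<le> m 0")
    case True
    show ?thesis
      using desubstitution_unique[OF ny[unfolded x(2)] m[unfolded x(2)] x(1) True] by simp
  next
    case False
    then have "m 0 \<le> n 0" by simp
    from desubstitution_unique[OF m[unfolded x(2)] ny[unfolded x(2)] x(1) this]
    show ?thesis by simp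
  qed
  have "\<exists>!p. case p of (n, y) \<Rightarrow> desubstitution z n y"
  proof (rule ex1I)
    show "case (n, y) of (n, y) \<Rightarrow> desubstitution z n y" using ny by simp
    show "p = (n, y)" if "case p of (n, y) \<Rightarrow> desubstitution z n y" for p
      using unique[of "fst p" "snd p"] that by (simp only: case_prod_beta prod.collapse)
  qed
  then show "\<exists>!(n, x). strict_mono (n :: int \<Rightarrow> int) \<and> n 0 \<le> 0 \<and> 0 < n 1 \<and>
         x \<in> subshift K \<sigma> \<and> (\<forall>k. \<sigma> (x k) = map z [n k .. n (k + 1) - 1])"
    unfolding desubstitution_def .
qed

end

theorem mainTheorem4:
  fixes X :: "'a::metric_space set" and T :: "'a \<Rightarrow> 'a"
  assumes "minimal_cantor_system X T"
    and "self_induced X T"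
  shows "\<exists>K \<sigma>. alphabet_space K \<and> gen_subst K \<sigma> \<and> primitive K \<sigma> \<and> aperiodic K \<sigma> \<and>
           recognizable K \<sigma> \<and> conjugate X T (subshift K \<sigma>) shift"
proof -
  obtain T' where "minimal_homeo X T T'"
    using minimal_cantor_system_imp_minimal_homeo[OF assms(1)] .
  then interpret minimal_homeo X T T' .
  have zd: "zero_dimensional X"
    using assms(1) by (simp add: minimal_cantor_system_def cantor_space_def)
  obtain \<psi>0 r0 where "inducing X T T' \<psi>0 r0" "\<psi>0 ` X \<noteq> X"
    using self_induced_imp_inducing[OF assms(2)] .
  then obtain \<psi> r where ind: "inducing X T T' \<psi> r" and r: "\<And>x. x \<in> X \<Longrightarrow> 2 \<le> r x"
    using inducing.inducing_with_returns_ge_2[OF _ _ zd] by metis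
  obtain e :: "'a \<Rightarrow> letter" and g where hom: "homeomorphism X (e ` X) e g"
    using zero_dimensional_compact_embeds[OF compact_X zd] .
  interpret coding X T T' \<psi> r "e ` X" e g
    by (intro coding.intro coding_axioms.intro ind hom r)
  obtain x where x: "x \<in> X" using nonempty by auto
  \<comment> \<open>T has no fixed point, which supplies two distinct letters.\<close>
  have "e (T x) \<noteq> e x" using g_e[OF x] g_e[OF T_in[OF x]] no_periodic[OF x, of 1] by auto
  then have "alphabet_space (e ` X)"
    unfolding alphabet_space_def
    using compact_continuous_image[OF e_cont compact_X] zero_dimensional_homeomorphic_image[OF zd hom]
    by (intro conjI bexI[of _ "e (T x)"] bexI[of _ "e x"]) (use x in auto)
  with gen_subst primitive aperiodic recognizable conjugate show ?thesis
    by (intro exI conjI)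
qed

end
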